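(* Let $(X,d_{\mathbb{D}})$ and $(Y,\rho_{\mathbb{D}})$ be two $\mathbb{D}$-metric spaces and assume that $(Y,\rho_{\mathbb{D}})$ is $\mathbb{D}$-complete. Let $Cb_{\mathbb{D}}(X,Y)$ be the set of all functions $f:X\to Y$ that are both $\mathbb{D}$-continuous and $\mathbb{D}$-bounded, with the $\mathbb{D}$-metric $\sigma_{\mathbb{D}}(f,g)=\sup\{\rho_{\mathbb{D}}(f(x),g(x)) : x\in X\}$. Then $(Cb_{\mathbb{D}}(X,Y),\sigma_{\mathbb{D}})$ is also $\mathbb{D}$-complete.
   Context: Hyperbolic numbers: $\mathbb{D}=\{a_1+\mathbf{k}a_2: a_1,a_2\in\mathbb{R}\}$ with $\mathbf{k}^2=1$, a commutative ring. With $\mathbf{e}_1=\frac{1+\mathbf{k}}{2}$, $\mathbf{e}_2=\frac{1-\mathbf{k}}{2}$, every $\alpha\in\mathbb{D}$ is uniquely $\alpha=\alpha_1\mathbf{e}_1+\alpha_2\mathbf{e}_2$ with $\alpha_1,\alpha_2\in\mathbb{R}$; sums and products are computed componentwise. Write $\alpha\preceq\beta$ if $\alpha_1\le\beta_1$ and $\alpha_2\le\beta_2$, and $\alpha\prec\beta$ if $\alpha_1<\beta_1$ and $\alpha_2<\beta_2$. Let $\mathbb{D}^+=\{\alpha:\alpha_1,\alpha_2>0\}$ and $\mathbb{D}_0^+=\{\alpha:\alpha_1,\alpha_2\ge 0\}$. For $A\subset\mathbb{D}$, $\sup A=(\sup A_{\mathbf{e}_1})\mathbf{e}_1+(\sup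 A_{\mathbf{e}_2})\mathbf{e}_2$, where $A_{\mathbf{e}_1}$ and $A_{\mathbf{e}_2}$ are the sets of first and second components of elements of $A$. A $\mathbb{D}$-metric on a nonempty set $X$ is a function $d_{\mathbb{D}}:X\times X\to\mathbb{D}_0^+$ such that for all $x,y,z\in X$: $d_{\mathbb{D}}(x,y)=0$ iff $x=y$; $d_{\mathbb{D}}(x,y)=d_{\mathbb{D}}(y,x)$; $d_{\mathbb{D}}(x,y)\preceq d_{\mathbb{D}}(x,z)+d_{\mathbb{D}}(z,y)$. Then $(X,d_{\mathbb{D}})$ is a $\mathbb{D}$-metric space. A sequence $\{x_n\}$ in $X$ converges to $\alpha\in X$ if for every $\epsilon\in\mathbb{D}^+$ there is $N\in\mathbb{N}$ with $d_{\mathbb{D}}(x_n,\alpha)\prec\epsilon$ for all $n\ge N$. It is $\mathbb{D}$-Cauchy if for every $\epsilon\in\mathbb{D}^+$ there is $N$ with $d_{\mathbb{D}}(x_n,x_m)\prec\epsilon$ for all $n,m\ge N$. A $\mathbb{D}$-metric space is $\mathbb{D}$-complete if every $\mathbb{D}$-Cauchy sequence in it converges to a point of it. A function $f:X\to Y$ is $\mathbb{D}$-continuous if for every $\alpha\in X$ and every $\epsilon\in\mathbb{D}^+$ there is $\delta\in\mathbb{D}^+$ such that $\rho_{\mathbb{D}}(f(x),f(\alpha))\prec\epsilon$ whenever $d_{\mathbb{D}}(x,\alpha)\prec\delta$. It is $\mathbb{D}$-bounded if there is $M\in\mathbb{D}^+$ with $\rho_{\mathbb{D}}(f(u),f(v))\preceq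 M$ for all $u,v\in X$. *)

theory Defs
  imports "HOL-Analysis.Analysis"
begin

text \<open>The hyperbolic number \<open>a\<^sub>1 + k a\<^sub>2\<close> is \<open>Hyperbolic a\<^sub>1 a\<^sub>2\<close>.\<close>

datatype hyperbolic = Hyperbolic (rpart: real) (hpart: real)

lemma hyperbolic_eq_iff: "z = w \<longleftrightarrow> rpart z = rpart w \<and> hpart z = hpart w"
  by (cases z; cases w) auto

instantiation hyperbolic :: real_algebra_1
begin

definition "0 = Hyperbolic 0 0"
definition "1 = Hyperbolic 1 0"
definition "z + w = Hyperbolic (rpart z + rpart w) (hpart z + hpart w)"
definition "- z = Hyperbolic (- rpart z) (- hpart z)"
definition "z - w = Hyperbolic (rpart z - rpart w) (hpart z - hpart w)"
definition "r *\<^sub>R z = Hyperbolic (r * rpart z) (r * hpart z)"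

text \<open>Multiplication is determined by bilinearity and \<open>k\<^sup>2 = 1\<close>.\<close>
definition "z * w = Hyperbolic (rpart z * rpart w + hpart z * hpart w)
                               (rpart z * hpart w + hpart z * rpart w)"

instance
  by standard
    (simp_all add: hyperbolic_eq_iff zero_hyperbolic_def one_hyperbolic_def plus_hyperbolic_def
      uminus_hyperbolic_def minus_hyperbolic_def scaleR_hyperbolic_def times_hyperbolic_def
      algebra_simps)

end

instance hyperbolic :: comm_ring_1
  by standard
    (simp_all add: hyperbolic_eq_iff one_hyperbolic_def plus_hyperbolic_def times_hyperbolic_def
      algebra_simps)

definition hyp_k :: hyperbolic where "hyp_k = Hyperbolic 0 1"

definition hyp_e1 :: hyperbolic where "hyp_e1 = (1/2) *\<^sub>R (1 + hyp_k)"
definition hyp_e2 :: hyperbolic where "hyp_e2 = (1/2) *\<^sub>R (1 - hyp_k)"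

lemmas hyperbolic_defs = hyperbolic_eq_iff zero_hyperbolic_def one_hyperbolic_def
  plus_hyperbolic_def uminus_hyperbolic_def minus_hyperbolic_def scaleR_hyperbolic_def
  times_hyperbolic_def hyp_k_def hyp_e1_def hyp_e2_def

lemma Hyperbolic_eq: "Hyperbolic a b = of_real a + hyp_k * of_real b"
  by (simp add: hyperbolic_defs of_real_def)

lemma hyp_k_square: "hyp_k\<^sup>2 = 1"
  by (simp add: hyperbolic_defs power2_eq_square)

text \<open>Coefficients with respect to \<open>hyp_e1\<close>, \<open>hyp_e2\<close>; see \<open>hyp_decomposition\<close> below.\<close>
definition comp1 :: "hyperbolic \<Rightarrow> real" where "comp1 z = rpart z + hpart z"
definition comp2 :: "hyperbolic \<Rightarrow> real" where "comp2 z = rpart z - hpart z"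

lemma hyp_decomposition:
  "z = a *\<^sub>R hyp_e1 + b *\<^sub>R hyp_e2 \<longleftrightarrow> a = comp1 z \<and> b = comp2 z"
  by (auto simp: hyperbolic_defs comp1_def comp2_def field_simps)

lemma comp_simps [simp]:
  "comp1 0 = 0" "comp2 0 = 0" "comp1 1 = 1" "comp2 1 = 1"
  "comp1 (z + w) = comp1 z + comp1 w" "comp2 (z + w) = comp2 z + comp2 w"
  "comp1 (z * w) = comp1 z * comp1 w" "comp2 (z * w) = comp2 z * comp2 w"
  "comp1 (a *\<^sub>R hyp_e1 + b *\<^sub>R hyp_e2) = a" "comp2 (a *\<^sub>R hyp_e1 + b *\<^sub>R hyp_e2) = b"
  by (simp_all add: hyperbolic_defs comp1_def comp2_def algebra_simps)

text \<open>The strict relation is strict in both components, so it is not the strict part of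
  \<open>hyp_le\<close>; hence the order type classes are not instantiated.\<close>
definition hyp_le :: "hyperbolic \<Rightarrow> hyperbolic \<Rightarrow> bool" (infix "\<preceq>" 50)
  where "z \<preceq> w \<longleftrightarrow> comp1 z \<le> comp1 w \<and> comp2 z \<le> comp2 w"

definition hyp_less :: "hyperbolic \<Rightarrow> hyperbolic \<Rightarrow> bool" (infix "\<prec>" 50)
  where "z \<prec> w \<longleftrightarrow> comp1 z < comp1 w \<and> comp2 z < comp2 w"

definition hyp_pos :: "hyperbolic set"
  where "hyp_pos = {z. comp1 z > 0 \<and> comp2 z > 0}"

definition hyp_nonneg :: "hyperbolic set"
  where "hyp_nonneg = {z. comp1 z \<ge> 0 \<and> comp2 z \<ge> 0}"

text \<open>Like the real \<open>Sup\<close>, meaningful only if \<open>A\<close> is nonempty and bounded above.\<close>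
definition hyp_Sup :: "hyperbolic set \<Rightarrow> hyperbolic"
  where "hyp_Sup A = Sup (comp1 ` A) *\<^sub>R hyp_e1 + Sup (comp2 ` A) *\<^sub>R hyp_e2"

locale D_metric_space =
  fixes M :: "'a set" and d :: "'a \<Rightarrow> 'a \<Rightarrow> hyperbolic"
  assumes nonempty: "M \<noteq> {}"
    and nonneg: "\<lbrakk>x \<in> M; y \<in> M\<rbrakk> \<Longrightarrow> d x y \<in> hyp_nonneg"
    and zero_iff: "\<lbrakk>x \<in> M; y \<in> M\<rbrakk> \<Longrightarrow> d x y = 0 \<longleftrightarrow> x = y"
    and commute: "\<lbrakk>x \<in> M; y \<in> M\<rbrakk> \<Longrightarrow> d x y = d y x"
    and triangle: "\<lbrakk>x \<in> M; y \<in> M; z \<in> M\<rbrakk> \<Longrightarrow> d x y \<preceq> d x z + d z y"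

definition D_converges :: "'a set \<Rightarrow> ('a \<Rightarrow> 'a \<Rightarrow> hyperbolic) \<Rightarrow> (nat \<Rightarrow> 'a) \<Rightarrow> 'a \<Rightarrow> bool"
  where "D_converges M d s a \<longleftrightarrow>
    a \<in> M \<and> (\<forall>n. s n \<in> M) \<and> (\<forall>\<epsilon>\<in>hyp_pos. \<exists>N. \<forall>n\<ge>N. d (s n) a \<prec> \<epsilon>)"

definition D_Cauchy :: "'a set \<Rightarrow> ('a \<Rightarrow> 'a \<Rightarrow> hyperbolic) \<Rightarrow> (nat \<Rightarrow> 'a) \<Rightarrow> bool"
  where "D_Cauchy M d s \<longleftrightarrow>
    (\<forall>n. s n \<in> M) \<and> (\<forall>\<epsilon>\<in>hyp_pos. \<exists>N. \<forall>n\<ge>N. \<forall>m\<ge>N. d (s n) (s m) \<prec> \<epsilon>)"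

definition D_complete :: "'a set \<Rightarrow> ('a \<Rightarrow> 'a \<Rightarrow> hyperbolic) \<Rightarrow> bool"
  where "D_complete M d \<longleftrightarrow> (\<forall>s. D_Cauchy M d s \<longrightarrow> (\<exists>a. D_converges M d s a))"

definition D_continuous ::
    "'a set \<Rightarrow> ('a \<Rightarrow> 'a \<Rightarrow> hyperbolic) \<Rightarrow> ('b \<Rightarrow> 'b \<Rightarrow> hyperbolic) \<Rightarrow> ('a \<Rightarrow> 'b) \<Rightarrow> bool"
  where "D_continuous X d \<rho> f \<longleftrightarrow>
    (\<forall>a\<in>X. \<forall>\<epsilon>\<in>hyp_pos. \<exists>\<delta>\<in>hyp_pos. \<forall>x\<in>X. d x a \<prec> \<delta> \<longrightarrow> \<rho> (f x) (f a) \<prec> \<epsilon>)"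

definition D_bounded :: "'a set \<Rightarrow> ('b \<Rightarrow> 'b \<Rightarrow> hyperbolic) \<Rightarrow> ('a \<Rightarrow> 'b) \<Rightarrow> bool"
  where "D_bounded X \<rho> f \<longleftrightarrow> (\<exists>B\<in>hyp_pos. \<forall>u\<in>X. \<forall>v\<in>X. \<rho> (f u) (f v) \<preceq> B)"

text \<open>Functions \<open>X \<rightarrow> Y\<close> are taken extensional (\<open>undefined\<close> outside \<open>X\<close>), so that equality in
  \<open>Cb\<close> is equality on \<open>X\<close>.\<close>
definition Cb ::
    "'a set \<Rightarrow> ('a \<Rightarrow> 'a \<Rightarrow> hyperbolic) \<Rightarrow> 'b set \<Rightarrow> ('b \<Rightarrow> 'b \<Rightarrow> hyperbolic) \<Rightarrow> ('a \<Rightarrow> 'b) set"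
  where "Cb X d Y \<rho> = {f \<in> X \<rightarrow>\<^sub>E Y. D_continuous X d \<rho> f \<and> D_bounded X \<rho> f}"

definition sup_dist ::
    "'a set \<Rightarrow> ('b \<Rightarrow> 'b \<Rightarrow> hyperbolic) \<Rightarrow> ('a \<Rightarrow> 'b) \<Rightarrow> ('a \<Rightarrow> 'b) \<Rightarrow> hyperbolic"
  where "sup_dist X \<rho> f g = hyp_Sup {\<rho> (f x) (g x) |x. x \<in> X}"

end

theory Submission
  imports Defs
begin

text \<open>
  The proof is the classical one for the space of bounded continuous maps into a complete metric
  space, and it works because both relations \<open>\<preceq>\<close> and \<open>\<prec>\<close> are conjunctions of real inequalities
  between the idempotent components. The failure of \<open>\<preceq>\<close> to be total does no harm: suprema,
  halving and thirding of an \<open>\<epsilon> \<in> hyp_pos\<close>, and addition of estimates are all componentwise.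

  The supremum \<open>sup_dist X \<rho> f g\<close> is the least upper bound, for \<open>\<preceq>\<close>, of the pointwise distances,
  provided these are bounded, which holds for bounded \<open>f\<close> and \<open>g\<close>
  (\<open>D_bounded_imp_dist_bounded\<close>). Each metric axiom for \<open>sup_dist\<close> then follows from the
  same axiom at every point of \<open>X\<close>.

  For completeness, a sequence that is Cauchy for \<open>sup_dist\<close> is uniformly Cauchy, so by
  completeness of \<open>Y\<close> it has a pointwise limit, which is attained uniformly
  (\<open>uniformly_Cauchy_imp_uniform_limit\<close>). Continuity and boundedness both survive uniform
  approximation, by the quadrilateral inequality: the distance of two values of the limit is at most
  that of the values of an approximating function, plus two approximation errors.
\<close>

section \<open>Componentwise order and suprema\<close>

lemma comp_scaleR [simp]: "comp1 (r *\<^sub>R z) = r * comp1 z" "comp2 (r *\<^sub>R z) = r * comp2 z"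
  by (simp_all add: hyperbolic_defs comp1_def comp2_def algebra_simps)

lemma comp_idempotents [simp]:
  "comp1 hyp_e1 = 1" "comp1 hyp_e2 = 0" "comp2 hyp_e1 = 0" "comp2 hyp_e2 = 1"
  by (simp_all add: hyperbolic_defs comp1_def comp2_def)

lemma hyperbolic_eq_iff_comp: "z = w \<longleftrightarrow> comp1 z = comp1 w \<and> comp2 z = comp2 w"
  by (metis hyp_decomposition)

lemma hyp_le_antisym: "z \<preceq> w \<Longrightarrow> w \<preceq> z \<Longrightarrow> z = w"
  by (auto simp: hyp_le_def hyperbolic_eq_iff_comp)

lemma hyp_le_trans: "z \<preceq> w \<Longrightarrow> w \<preceq> v \<Longrightarrow> z \<preceq> v"
  by (auto simp: hyp_le_def)

lemma hyp_le_less_trans: "z \<preceq> w \<Longrightarrow> w \<prec> v \<Longrightarrow> z \<prec> v"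
  by (auto simp: hyp_le_def hyp_less_def)

lemma hyp_nonneg_iff: "z \<in> hyp_nonneg \<longleftrightarrow> 0 \<preceq> z"
  by (simp add: hyp_nonneg_def hyp_le_def)

lemma hyp_pos_iff: "z \<in> hyp_pos \<longleftrightarrow> 0 \<prec> z"
  by (simp add: hyp_pos_def hyp_less_def)

lemma one_in_hyp_pos: "1 \<in> hyp_pos"
  by (simp add: hyp_pos_def)

lemma add_in_hyp_pos: "z \<in> hyp_pos \<Longrightarrow> w \<in> hyp_pos \<Longrightarrow> z + w \<in> hyp_pos"
  by (simp add: hyp_pos_def)

lemma scaleR_in_hyp_pos: "0 < r \<Longrightarrow> \<epsilon> \<in> hyp_pos \<Longrightarrow> r *\<^sub>R \<epsilon> \<in> hyp_pos"
  by (simp add: hyp_pos_def)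

lemma hyp_Sup_upper:
  assumes "z \<in> A" and "\<And>w. w \<in> A \<Longrightarrow> w \<preceq> B"
  shows "z \<preceq> hyp_Sup A"
proof -
  have "bdd_above (comp1 ` A)" "bdd_above (comp2 ` A)"
    using assms(2) by (auto simp: hyp_le_def intro!: bdd_aboveI2)
  then show ?thesis
    using assms(1) by (simp add: hyp_le_def hyp_Sup_def cSup_upper)
qed

lemma hyp_Sup_least:
  assumes "A \<noteq> {}" and "\<And>w. w \<in> A \<Longrightarrow> w \<preceq> B"
  shows "hyp_Sup A \<preceq> B"
  using assms by (auto simp: hyp_le_def hyp_Sup_def intro!: cSUP_least)

section \<open>Bounded and continuous maps into a hyperbolic metric space\<close>

context D_metric_space
begin

lemma dist_self [simp]: "x \<in> M \<Longrightarrow> d x x = 0"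
  by (simp add: zero_iff)

text \<open>The orientation of the outer two distances is the one in which a function \<open>g\<close> approximating
  \<open>F\<close> contributes the errors \<open>d (g x) (F x)\<close>.\<close>
lemma quadrilateral:
  assumes "x \<in> M" "y \<in> M" "u \<in> M" "v \<in> M"
  shows "d x y \<preceq> d u x + d u v + d v y"
  using triangle[of x y u] triangle[of u y v] commute[of x u] assms
  by (auto simp: hyp_le_def)

text \<open>Comparing with the values at one base point bounds the distance everywhere.\<close>
lemma D_bounded_imp_dist_bounded:
  assumes f: "f \<in> X \<rightarrow> M" "D_bounded X d f" and g: "g \<in> X \<rightarrow> M" "D_bounded X d g"
  obtains B where "\<And>x. x \<in> X \<Longrightarrow> d (f x) (g x) \<preceq> B"
proof (cases "X = {}")
  case True
  then show ?thesis using that by blast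
next
  case False
  then obtain a where a: "a \<in> X" by blast
  from f(2) g(2) obtain B C
    where B: "\<And>u v. u \<in> X \<Longrightarrow> v \<in> X \<Longrightarrow> d (f u) (f v) \<preceq> B"
      and C: "\<And>u v. u \<in> X \<Longrightarrow> v \<in> X \<Longrightarrow> d (g u) (g v) \<preceq> C"
    unfolding D_bounded_def by blast
  have "d (f x) (g x) \<preceq> B + d (f a) (g a) + C" if x: "x \<in> X" for x
  proof -
    have "d (f x) (g x) \<preceq> d (f a) (f x) + d (f a) (g a) + d (g a) (g x)"
      using quadrilateral f(1) g(1) a x by (simp add: Pi_iff)
    with B[OF a x] C[OF a x] show ?thesis by (auto simp: hyp_le_def)
  qed
  then show ?thesis by (rule that)
qed

lemma D_bounded_if_near_bounded:
  assumes "g \<in> X \<rightarrow> M" "F \<in> X \<rightarrow> M" "D_bounded X d g"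
    and E: "E \<in> hyp_pos" and near: "\<And>x. x \<in> X \<Longrightarrow> d (g x) (F x) \<preceq> E"
  shows "D_bounded X d F"
proof -
  from assms(3) obtain B where B: "B \<in> hyp_pos"
    and bound: "\<And>u v. u \<in> X \<Longrightarrow> v \<in> X \<Longrightarrow> d (g u) (g v) \<preceq> B"
    unfolding D_bounded_def by blast
  have "E + B + E \<in> hyp_pos" by (intro add_in_hyp_pos E B)
  moreover have "d (F u) (F v) \<preceq> E + B + E" if u: "u \<in> X" and v: "v \<in> X" for u v
  proof -
    have "d (F u) (F v) \<preceq> d (g u) (F u) + d (g u) (g v) + d (g v) (F v)"
      using quadrilateral assms(1,2) u v by (simp add: Pi_iff)
    with near[OF u] near[OF v] bound[OF u v] show ?thesis
      unfolding hyp_le_def comp_simps by (intro conjI; linarith)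
  qed
  ultimately show ?thesis unfolding D_bounded_def by blast
qed

text \<open>A third of \<open>\<epsilon>\<close> is spent on each side of the quadrilateral: two approximation errors, and the
  variation of the approximating function.\<close>
lemma D_continuous_if_uniformly_approximable:
  assumes F: "F \<in> X \<rightarrow> M"
    and approx: "\<And>\<epsilon>. \<epsilon> \<in> hyp_pos \<Longrightarrow>
      \<exists>g. g \<in> X \<rightarrow> M \<and> D_continuous X \<delta> d g \<and> (\<forall>x\<in>X. d (g x) (F x) \<preceq> \<epsilon>)"
  shows "D_continuous X \<delta> d F"
  unfolding D_continuous_def
proof (intro ballI)
  fix a \<epsilon> assume a: "a \<in> X" and "\<epsilon> \<in> hyp_pos"
  then have third: "(1/3) *\<^sub>R \<epsilon> \<in> hyp_pos" by (simp add: scaleR_in_hyp_pos)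
  then obtain g where g: "g \<in> X \<rightarrow> M" "D_continuous X \<delta> d g"
    and near: "\<And>x. x \<in> X \<Longrightarrow> d (g x) (F x) \<preceq> (1/3) *\<^sub>R \<epsilon>"
    using approx by blast
  from g(2) a third obtain \<eta> where \<eta>: "\<eta> \<in> hyp_pos"
    and close: "\<And>x. x \<in> X \<Longrightarrow> \<delta> x a \<prec> \<eta> \<Longrightarrow> d (g x) (g a) \<prec> (1/3) *\<^sub>R \<epsilon>"
    unfolding D_continuous_def by blast
  have "d (F x) (F a) \<prec> \<epsilon>" if x: "x \<in> X" and "\<delta> x a \<prec> \<eta>" for x
  proof -
    have "d (F x) (F a) \<preceq> d (g x) (F x) + d (g x) (g a) + d (g a) (F a)"
      using quadrilateral F g(1) a x by (simp add: Pi_iff)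
    with near[OF x] near[OF a] close[OF that] show ?thesis
      by (auto simp: hyp_le_def hyp_less_def)
  qed
  with \<eta> show "\<exists>\<eta>\<in>hyp_pos. \<forall>x\<in>X. \<delta> x a \<prec> \<eta> \<longrightarrow> d (F x) (F a) \<prec> \<epsilon>" by blast
qed

text \<open>The pointwise limit inherits the rate of the uniform Cauchy condition: to estimate the error of
  \<open>s n\<close> at \<open>x\<close>, compare with \<open>s m x\<close> for an \<open>m\<close> that may depend on \<open>x\<close>, while the
  bound on \<open>d (s n x) (s m x)\<close> does not.\<close>
lemma uniformly_Cauchy_imp_uniform_limit:
  fixes s :: "nat \<Rightarrow> 'b \<Rightarrow> 'a"
  assumes complete: "D_complete M d" and s: "\<And>n. s n \<in> X \<rightarrow> M"
    and Cauchy: "\<And>\<epsilon>. \<epsilon> \<in> hyp_pos \<Longrightarrow>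
      \<exists>N. \<forall>n\<ge>N. \<forall>m\<ge>N. \<forall>x\<in>X. d (s n x) (s m x) \<prec> \<epsilon>"
  obtains F where "F \<in> X \<rightarrow>\<^sub>E M"
    and "\<forall>\<epsilon>\<in>hyp_pos. \<exists>N. \<forall>n\<ge>N. \<forall>x\<in>X. d (s n x) (F x) \<preceq> \<epsilon>"
proof -
  have "\<exists>l. D_converges M d (\<lambda>n. s n x) l" if x: "x \<in> X" for x
  proof -
    have "D_Cauchy M d (\<lambda>n. s n x)"
      unfolding D_Cauchy_def
    proof (intro conjI allI ballI)
      show "s n x \<in> M" for n using s x by blast
      show "\<exists>N. \<forall>n\<ge>N. \<forall>m\<ge>N. d (s n x) (s m x) \<prec> \<epsilon>" if "\<epsilon> \<in> hyp_pos" for \<epsilon>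
        using Cauchy[OF that] x by blast
    qed
    with complete show ?thesis by (simp add: D_complete_def)
  qed
  then obtain L where L: "\<And>x. x \<in> X \<Longrightarrow> D_converges M d (\<lambda>n. s n x) (L x)"
    by metis
  define F where "F = restrict L X"
  have F: "F \<in> X \<rightarrow>\<^sub>E M" using L by (auto simp: F_def D_converges_def)
  moreover have "\<exists>N. \<forall>n\<ge>N. \<forall>x\<in>X. d (s n x) (F x) \<preceq> \<epsilon>" if "\<epsilon> \<in> hyp_pos" for \<epsilon>
  proof -
    have half: "(1/2) *\<^sub>R \<epsilon> \<in> hyp_pos" using that by (simp add: scaleR_in_hyp_pos)
    then obtain N where N: "\<And>n m x. \<lbrakk>n \<ge> N; m \<ge> N; x \<in> X\<rbrakk> \<Longrightarrow> d (s n x) (s m x) \<prec> (1/2) *\<^sub>R \<epsilon>"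
      using Cauchy by meson
    have "d (s n x) (F x) \<preceq> \<epsilon>" if n: "n \<ge> N" and x: "x \<in> X" for n x
    proof -
      from L[OF x] half obtain K where K: "\<And>m. m \<ge> K \<Longrightarrow> d (s m x) (F x) \<prec> (1/2) *\<^sub>R \<epsilon>"
        unfolding D_converges_def F_def restrict_apply'[OF x] by blast
      define m where "m = max N K"
      have "d (s n x) (F x) \<preceq> d (s n x) (s m x) + d (s m x) (F x)"
        using triangle s F x by (simp add: Pi_iff PiE_iff)
      moreover have "d (s n x) (s m x) \<prec> (1/2) *\<^sub>R \<epsilon>" "d (s m x) (F x) \<prec> (1/2) *\<^sub>R \<epsilon>"
        using N[OF n _ x] K by (simp_all add: m_def)
      ultimately show ?thesis by (auto simp: hyp_le_def hyp_less_def)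
    qed
    then show ?thesis by blast
  qed
  ultimately show ?thesis using that by blast
qed

lemma D_bounded_const: "c \<in> M \<Longrightarrow> D_bounded X d (restrict (\<lambda>_. c) X)"
  unfolding D_bounded_def by (rule bexI[OF _ one_in_hyp_pos]) (simp add: hyp_le_def)

lemma D_continuous_const: "c \<in> M \<Longrightarrow> D_continuous X \<delta> d (restrict (\<lambda>_. c) X)"
  unfolding D_continuous_def using one_in_hyp_pos by (auto simp: hyp_pos_iff)

section \<open>The supremum distance\<close>

text \<open>Membership in \<open>Cb\<close> provides the boundedness without which the supremum would be meaningless.\<close>
lemma dist_le_sup_dist:
  assumes "f \<in> Cb X \<delta> M d" "g \<in> Cb X \<delta> M d" "x \<in> X"
  shows "d (f x) (g x) \<preceq> sup_dist X d f g"
proof -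
  obtain B where "\<And>x. x \<in> X \<Longrightarrow> d (f x) (g x) \<preceq> B"
    using D_bounded_imp_dist_bounded[of f X g] assms(1,2) by (auto simp: Cb_def PiE_def)
  then show ?thesis
    unfolding sup_dist_def using assms(3) by (intro hyp_Sup_upper[where B = B]) auto
qed

lemma sup_dist_le:
  assumes "X \<noteq> {}" "\<And>x. x \<in> X \<Longrightarrow> d (f x) (g x) \<preceq> B"
  shows "sup_dist X d f g \<preceq> B"
  unfolding sup_dist_def using assms by (intro hyp_Sup_least) auto

lemma D_metric_space_Cb:
  assumes X: "X \<noteq> {}"
  shows "D_metric_space (Cb X \<delta> M d) (sup_dist X d)"
proof
  obtain c where "c \<in> M" using nonempty by blast
  then have "restrict (\<lambda>_. c) X \<in> Cb X \<delta> M d"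
    by (simp add: Cb_def D_bounded_const D_continuous_const)
  then show "Cb X \<delta> M d \<noteq> {}" by blast
next
  fix f g assume f: "f \<in> Cb X \<delta> M d" and g: "g \<in> Cb X \<delta> M d"
  have vals: "f x \<in> M" "g x \<in> M" if "x \<in> X" for x
    using f g that by (auto simp: Cb_def)
  obtain a where a: "a \<in> X" using X by blast
  have "0 \<preceq> d (f a) (g a)"
    using nonneg vals a by (simp add: hyp_nonneg_iff)
  from hyp_le_trans[OF this dist_le_sup_dist[OF f g a]]
  have sup_nonneg: "0 \<preceq> sup_dist X d f g" .
  then show "sup_dist X d f g \<in> hyp_nonneg" by (simp add: hyp_nonneg_iff)
  show "sup_dist X d f g = 0 \<longleftrightarrow> f = g"
  proof
    assume zero: "sup_dist X d f g = 0"
    show "f = g"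
    proof (rule PiE_ext)
      show "f \<in> X \<rightarrow>\<^sub>E M" "g \<in> X \<rightarrow>\<^sub>E M" using f g by (simp_all add: Cb_def)
      fix x assume x: "x \<in> X"
      have "d (f x) (g x) = 0"
        using dist_le_sup_dist[OF f g x] nonneg[OF vals[OF x]]
        by (simp add: zero hyp_nonneg_iff hyp_le_antisym)
      then show "f x = g x" using zero_iff vals x by blast
    qed
  next
    assume "f = g"
    then have "sup_dist X d f g \<preceq> 0"
      using vals by (intro sup_dist_le[OF X]) (simp add: hyp_le_def)
    with sup_nonneg show "sup_dist X d f g = 0" by (simp add: hyp_le_antisym)
  qed
  have "{d (f x) (g x) |x. x \<in> X} = {d (g x) (f x) |x. x \<in> X}"
    using commute vals by metis
  then show "sup_dist X d f g = sup_dist X d g f" by (simp add: sup_dist_def)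
  fix h assume h: "h \<in> Cb X \<delta> M d"
  show "sup_dist X d f g \<preceq> sup_dist X d f h + sup_dist X d h g"
  proof (rule sup_dist_le[OF X])
    fix x assume x: "x \<in> X"
    then have "h x \<in> M" using h by (auto simp: Cb_def)
    then have "d (f x) (g x) \<preceq> d (f x) (h x) + d (h x) (g x)"
      using triangle vals x by blast
    with dist_le_sup_dist[OF f h x] dist_le_sup_dist[OF h g x]
    show "d (f x) (g x) \<preceq> sup_dist X d f h + sup_dist X d h g"
      by (auto simp: hyp_le_def)
  qed
qed

lemma D_complete_Cb:
  assumes X: "X \<noteq> {}" and complete: "D_complete M d"
  shows "D_complete (Cb X \<delta> M d) (sup_dist X d)"
  unfolding D_complete_def
proof (intro allI impI)
  fix s assume s_Cauchy: "D_Cauchy (Cb X \<delta> M d) (sup_dist X d) s"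
  then have s: "s n \<in> Cb X \<delta> M d" for n by (simp add: D_Cauchy_def)
  then have s_Pi: "s n \<in> X \<rightarrow> M" for n by (auto simp: Cb_def)
  have "\<exists>N. \<forall>n\<ge>N. \<forall>m\<ge>N. \<forall>x\<in>X. d (s n x) (s m x) \<prec> \<epsilon>" if "\<epsilon> \<in> hyp_pos" for \<epsilon>
  proof -
    obtain N where N: "\<forall>n\<ge>N. \<forall>m\<ge>N. sup_dist X d (s n) (s m) \<prec> \<epsilon>"
      using s_Cauchy \<open>\<epsilon> \<in> hyp_pos\<close> unfolding D_Cauchy_def by blast
    have "d (s n x) (s m x) \<prec> \<epsilon>" if "n \<ge> N" "m \<ge> N" "x \<in> X" for n m x
      by (rule hyp_le_less_trans[OF dist_le_sup_dist[OF s s]]) (use N that in auto)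
    then show ?thesis by blast
  qed
  then obtain F where F: "F \<in> X \<rightarrow>\<^sub>E M"
    and lim: "\<forall>\<epsilon>\<in>hyp_pos. \<exists>N. \<forall>n\<ge>N. \<forall>x\<in>X. d (s n x) (F x) \<preceq> \<epsilon>"
    by (rule uniformly_Cauchy_imp_uniform_limit[where s = s, OF complete s_Pi])
  then have F_Pi: "F \<in> X \<rightarrow> M" by auto
  have "D_continuous X \<delta> d F"
  proof (rule D_continuous_if_uniformly_approximable[OF F_Pi])
    fix \<epsilon> assume "\<epsilon> \<in> hyp_pos"
    then obtain N where "\<forall>x\<in>X. d (s N x) (F x) \<preceq> \<epsilon>" using lim by blast
    then show "\<exists>g. g \<in> X \<rightarrow> M \<and> D_continuous X \<delta> d g \<and> (\<forall>x\<in>X. d (g x) (F x) \<preceq> \<epsilon>)"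
      using s[of N] s_Pi[of N] by (auto simp: Cb_def)
  qed
  moreover have "D_bounded X d F"
  proof -
    obtain N where "\<And>x. x \<in> X \<Longrightarrow> d (s N x) (F x) \<preceq> 1"
      using bspec[OF lim one_in_hyp_pos] by blast
    then show ?thesis
      using D_bounded_if_near_bounded[OF s_Pi F_Pi _ one_in_hyp_pos] s[of N]
      by (auto simp: Cb_def)
  qed
  ultimately have F_Cb: "F \<in> Cb X \<delta> M d" using F by (simp add: Cb_def)
  have "\<exists>N. \<forall>n\<ge>N. sup_dist X d (s n) F \<prec> \<epsilon>" if "\<epsilon> \<in> hyp_pos" for \<epsilon>
  proof -
    \<comment> \<open>A supremum preserves only weak bounds; half of \<open>\<epsilon>\<close> is the slack for the strict one.\<close>
    obtain N where "\<And>n x. n \<ge> N \<Longrightarrow> x \<in> X \<Longrightarrow> d (s n x) (F x) \<preceq> (1/2) *\<^sub>R \<epsilon>"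
      using bspec[OF lim scaleR_in_hyp_pos[of "1/2" \<epsilon>]] \<open>\<epsilon> \<in> hyp_pos\<close> by auto
    then have "sup_dist X d (s n) F \<preceq> (1/2) *\<^sub>R \<epsilon>" if "n \<ge> N" for n
      using that by (intro sup_dist_le[OF X])
    moreover have "(1/2) *\<^sub>R \<epsilon> \<prec> \<epsilon>" using that by (simp add: hyp_pos_def hyp_less_def)
    ultimately show ?thesis by (meson hyp_le_less_trans)
  qed
  with s F_Cb show "\<exists>F. D_converges (Cb X \<delta> M d) (sup_dist X d) s F"
    unfolding D_converges_def by blast
qed

end

theorem theorem37:
  fixes X :: "'a set" and d :: "'a \<Rightarrow> 'a \<Rightarrow> hyperbolic"
    and Y :: "'b set" and \<rho> :: "'b \<Rightarrow> 'b \<Rightarrow> hyperbolic"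
  assumes "D_metric_space X d"
    and "D_metric_space Y \<rho>"
    and "D_complete Y \<rho>"
  shows "D_metric_space (Cb X d Y \<rho>) (sup_dist X \<rho>) \<and> D_complete (Cb X d Y \<rho>) (sup_dist X \<rho>)"
proof -
  interpret Y: D_metric_space Y \<rho> by fact
  have "X \<noteq> {}" using assms(1) by (rule D_metric_space.nonempty)
  with assms(3) show ?thesis by (simp add: Y.D_metric_space_Cb Y.D_complete_Cb)
qed

end
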